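(* Let $G$ be a residually finite group, let $(G_n)$ be a sofic chain of finite-index subgroups, and let $\Sigma=(\sigma_n:G\to\mathrm{Sym}(G_n\backslash G))$ be the associated sofic approximation. If $K$ is a finite group and $X\subseteq K^G$ is an algebraic subshift of finite type, then $$h^\Sigma_{\mathrm{top}}(G\curvearrowright X)=\limsup_{n\to\infty}\frac1{|G:G_n|}\cdot\log\bigl|\mathrm{Fix}_{G_n}(X)\bigr|,$$ where $\mathrm{Fix}_{G_n}(X)=\{x\in X:g\cdot x=x\ \forall g\in G_n\}$ is the set of $G_n$-periodic elements of $X$.
   Context: Sofic chain: a decreasing sequence $(G_n)$ of finite-index (not necessarily normal) subgroups of a countable group $G$ such that for every $g\ne1_G$, $\lim_{n\to\infty}|\{G_nu:u\in G,\ g\in u^{-1}G_nu\}|/[G:G_n]=0$. The associated sofic approximation is $\Sigma=(\sigma_n)$ with $D_n=G_n\backslash G=\{G_nu:u\in G\}$ and $\sigma_n(g)(G_nu)=G_nug^{-1}$. (In general, a sofic approximation is a sequence of maps $\sigma_n:G\to\mathrm{Sym}(D_n)$ with $D_n$ finite that is asymptotically free and asymptotically an action.) Subshifts: $K^G$ has the product topology ($K$ discrete), pointwise group structure, and $G$-action $(g\cdot x)(h)=x(g^{-1}h)$. A subshift is a closed $G$-invariant subset $X\subseteq K^G$; it is algebraic if it is also a subgroup. With $\alpha:K^G\to K$, $\alpha(x)=x(1_G)$, it is of finite type if there are a finite $W\subseteq G$ and $P\subseteq K^W$ such that $X=\{x\in K^G:\forall g\in G\ \exists p\in P\ \forall w\in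 W\ \alpha(wg\cdot x)=p(w)\}$. Topological sofic entropy: Let $G\curvearrowright X$ be a continuous action on a compact metrizable space. Let $\rho$ be a continuous pseudo-metric on $X$ that is generating (for $x\ne y$ there is $g\in G$ with $\rho(g\cdot x,g\cdot y)>0$). For $\phi,\phi':D_n\to X$ let $\rho_2(\phi,\phi')=\bigl(\frac1{|D_n|}\sum_{i}\rho(\phi(i),\phi'(i))^2\bigr)^{1/2}$ and $\rho_\infty(\phi,\phi')=\max_i\rho(\phi(i),\phi'(i))$. For finite $F\subseteq G$, $\delta>0$ let $\mathrm{Map}(\rho,F,\delta,\sigma_n)=\{\phi:D_n\to X:\rho_2(\phi\circ\sigma_n(f),f\cdot\phi)<\delta\ \forall f\in F\}$, and let $N_\kappa(\cdot,\rho_\infty)$ be the maximum cardinality of a subset whose distinct elements satisfy $\rho_\infty(\phi,\phi')\ge\kappa$. Then $$h^\Sigma_{\mathrm{top}}(G\curvearrowright X)=\sup_{\kappa>0}\inf_{\delta>0}\inf_{F}\limsup_{n\to\infty}\frac1{|D_n|}\log N_\kappa(\mathrm{Map}(\rho,F,\delta,\sigma_n),\rho_\infty)$$ ($F$ ranging over finite subsets of $G$, $\log 0=-\infty$); this is independent of $\rho$. *)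

theory Defs
  imports "HOL-Analysis.Analysis" "HOL-Algebra.Product_Groups"
begin

section \<open>Residually finite groups and sofic chains\<close>

definition residually_finite :: "('g, 'b) monoid_scheme \<Rightarrow> bool" where
  "residually_finite G \<longleftrightarrow>
     (\<forall>g \<in> carrier G. g \<noteq> \<one>\<^bsub>G\<^esub> \<longrightarrow>
        (\<exists>N. N \<lhd> G \<and> finite (rcosets\<^bsub>G\<^esub> N) \<and> g \<notin> N))"

text \<open>The coset space \<open>H\G = {Hu | u \<in> G}\<close> is \<open>rcosets\<^bsub>G\<^esub> H\<close>, and the index
  \<open>[G:H]\<close> is its cardinality. The members of a chain need not be normal and the inclusions
  need not be strict.\<close>

definition sofic_chain :: "('g, 'b) monoid_scheme \<Rightarrow> (nat \<Rightarrow> 'g set) \<Rightarrow> bool" where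
  "sofic_chain G H \<longleftrightarrow>
     (\<forall>n. subgroup (H n) G \<and> finite (rcosets\<^bsub>G\<^esub> (H n))) \<and>
     (\<forall>n. H (Suc n) \<subseteq> H n) \<and>
     (\<forall>g \<in> carrier G. g \<noteq> \<one>\<^bsub>G\<^esub> \<longrightarrow>
        (\<lambda>n. real (card {H n #>\<^bsub>G\<^esub> u | u.
                 u \<in> carrier G \<and> g \<in> (inv\<^bsub>G\<^esub> u <#\<^bsub>G\<^esub> H n) #>\<^bsub>G\<^esub> u})
              / real (card (rcosets\<^bsub>G\<^esub> (H n)))) \<longlonglongrightarrow> 0)"

text \<open>The left action \<open>\<sigma>(g)(Hu) = Hug\<inverse>\<close> of \<open>G\<close> on \<open>H\G\<close>, written as right translation of
  subsets of \<open>G\<close>; see \<open>coset_perm_rcoset\<close> below.\<close>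

definition coset_perm :: "('g, 'b) monoid_scheme \<Rightarrow> 'g \<Rightarrow> 'g set \<Rightarrow> 'g set" where
  "coset_perm G g C = C #>\<^bsub>G\<^esub> inv\<^bsub>G\<^esub> g"

lemma coset_perm_rcoset:
  assumes "group G" "subgroup H G" "u \<in> carrier G" "g \<in> carrier G"
  shows "coset_perm G g (H #>\<^bsub>G\<^esub> u) = H #>\<^bsub>G\<^esub> (u \<otimes>\<^bsub>G\<^esub> inv\<^bsub>G\<^esub> g)"
  using assms unfolding coset_perm_def
  by (simp add: group.coset_mult_assoc group.inv_closed subgroup.subset)

section \<open>Subshifts\<close>

text \<open>Elements of \<open>K\<^sup>G\<close> are extensional functions, i.e. elements of
  \<open>carrier G \<rightarrow>\<^sub>E carrier K\<close>.\<close>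

definition shift ::
  "('g, 'b) monoid_scheme \<Rightarrow> 'g \<Rightarrow> ('g \<Rightarrow> 'k) \<Rightarrow> ('g \<Rightarrow> 'k)" where
  "shift G g x = (\<lambda>h \<in> carrier G. x (inv\<^bsub>G\<^esub> g \<otimes>\<^bsub>G\<^esub> h))"

definition config_topology ::
  "('g, 'b) monoid_scheme \<Rightarrow> ('k, 'c) monoid_scheme \<Rightarrow> ('g \<Rightarrow> 'k) topology" where
  "config_topology G K =
     product_topology (\<lambda>_. discrete_topology (carrier K)) (carrier G)"

definition subshift ::
  "('g, 'b) monoid_scheme \<Rightarrow> ('k, 'c) monoid_scheme \<Rightarrow> ('g \<Rightarrow> 'k) set \<Rightarrow> bool" where
  "subshift G K X \<longleftrightarrow>
     closedin (config_topology G K) X \<and> (\<forall>g \<in> carrier G. \<forall>x \<in> X. shift G g x \<in> X)"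

definition algebraic_subshift ::
  "('g, 'b) monoid_scheme \<Rightarrow> ('k, 'c) monoid_scheme \<Rightarrow> ('g \<Rightarrow> 'k) set \<Rightarrow> bool" where
  "algebraic_subshift G K X \<longleftrightarrow>
     subshift G K X \<and> subgroup X (product_group (carrier G) (\<lambda>_. K))"

definition finite_type ::
  "('g, 'b) monoid_scheme \<Rightarrow> ('k, 'c) monoid_scheme \<Rightarrow> ('g \<Rightarrow> 'k) set \<Rightarrow> bool" where
  "finite_type G K X \<longleftrightarrow>
     (\<exists>W P. finite W \<and> W \<subseteq> carrier G \<and> P \<subseteq> W \<rightarrow>\<^sub>E carrier K \<and>
        X = {x \<in> carrier G \<rightarrow>\<^sub>E carrier K.
               \<forall>g \<in> carrier G. \<exists>p \<in> P. \<forall>w \<in> W. shift G (w \<otimes>\<^bsub>G\<^esub> g) x \<one>\<^bsub>G\<^esub> = p w})"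

definition Fix_points ::
  "('g, 'b) monoid_scheme \<Rightarrow> 'g set \<Rightarrow> ('g \<Rightarrow> 'k) set \<Rightarrow> ('g \<Rightarrow> 'k) set" where
  "Fix_points G H X = {x \<in> X. \<forall>g \<in> H. shift G g x = x}"

section \<open>Topological sofic entropy\<close>

text \<open>In this section \<open>T\<close> is the topological space acted upon, \<open>act\<close> the action of \<open>G\<close> on it,
  \<open>D\<close> a finite index set, and \<open>s\<close> (for a single index) or \<open>\<sigma>\<close> (for the sequence) the sofic
  approximation. Values outside \<open>topspace T\<close>, \<open>carrier G\<close> and \<open>D\<close> are irrelevant.\<close>

definition continuous_pseudometric :: "'x topology \<Rightarrow> ('x \<Rightarrow> 'x \<Rightarrow> real) \<Rightarrow> bool" where
  "continuous_pseudometric T \<rho> \<longleftrightarrow>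
     (\<forall>x \<in> topspace T. \<forall>y \<in> topspace T. 0 \<le> \<rho> x y) \<and>
     (\<forall>x \<in> topspace T. \<rho> x x = 0) \<and>
     (\<forall>x \<in> topspace T. \<forall>y \<in> topspace T. \<rho> x y = \<rho> y x) \<and>
     (\<forall>x \<in> topspace T. \<forall>y \<in> topspace T. \<forall>z \<in> topspace T. \<rho> x z \<le> \<rho> x y + \<rho> y z) \<and>
     continuous_map (prod_topology T T) euclideanreal (\<lambda>(x, y). \<rho> x y)"

definition generating ::
  "('g, 'b) monoid_scheme \<Rightarrow> 'x topology \<Rightarrow> ('g \<Rightarrow> 'x \<Rightarrow> 'x) \<Rightarrow> ('x \<Rightarrow> 'x \<Rightarrow> real) \<Rightarrow> bool" where
  "generating G T act \<rho> \<longleftrightarrow>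
     (\<forall>x \<in> topspace T. \<forall>y \<in> topspace T. x \<noteq> y \<longrightarrow>
        (\<exists>g \<in> carrier G. 0 < \<rho> (act g x) (act g y)))"

definition rho2 :: "'d set \<Rightarrow> ('x \<Rightarrow> 'x \<Rightarrow> real) \<Rightarrow> ('d \<Rightarrow> 'x) \<Rightarrow> ('d \<Rightarrow> 'x) \<Rightarrow> real" where
  "rho2 D \<rho> \<phi> \<psi> = sqrt ((1 / real (card D)) * (\<Sum>i\<in>D. (\<rho> (\<phi> i) (\<psi> i))\<^sup>2))"

definition rho_inf :: "'d set \<Rightarrow> ('x \<Rightarrow> 'x \<Rightarrow> real) \<Rightarrow> ('d \<Rightarrow> 'x) \<Rightarrow> ('d \<Rightarrow> 'x) \<Rightarrow> real" where
  "rho_inf D \<rho> \<phi> \<psi> = Max ((\<lambda>i. \<rho> (\<phi> i) (\<psi> i)) ` D)"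

definition Map ::
  "'x topology \<Rightarrow> ('g \<Rightarrow> 'x \<Rightarrow> 'x) \<Rightarrow> ('x \<Rightarrow> 'x \<Rightarrow> real) \<Rightarrow> 'g set \<Rightarrow> real
     \<Rightarrow> 'd set \<Rightarrow> ('g \<Rightarrow> 'd \<Rightarrow> 'd) \<Rightarrow> ('d \<Rightarrow> 'x) set" where
  "Map T act \<rho> F \<delta> D s =
     {\<phi> \<in> D \<rightarrow>\<^sub>E topspace T. \<forall>f \<in> F. rho2 D \<rho> (\<phi> \<circ> s f) (\<lambda>i. act f (\<phi> i)) < \<delta>}"

text \<open>Maximal cardinality of a \<open>\<kappa>\<close>-separated subset, taken as a supremum in the extended
  naturals so that it is meaningful without first showing that such cardinalities are bounded.\<close>

definition sep_number :: "real \<Rightarrow> 'y set \<Rightarrow> ('y \<Rightarrow> 'y \<Rightarrow> real) \<Rightarrow> enat" where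
  "sep_number \<kappa> Z d =
     (SUP A \<in> {A. A \<subseteq> Z \<and> finite A \<and> (\<forall>a \<in> A. \<forall>b \<in> A. a \<noteq> b \<longrightarrow> \<kappa> \<le> d a b)}. enat (card A))"

definition log_enat :: "enat \<Rightarrow> ereal" where
  "log_enat N = (case N of enat m \<Rightarrow> if m = 0 then - \<infinity> else ereal (ln (real m)) | \<infinity> \<Rightarrow> \<infinity>)"

definition sofic_entropy ::
  "('g, 'b) monoid_scheme \<Rightarrow> 'x topology \<Rightarrow> ('g \<Rightarrow> 'x \<Rightarrow> 'x) \<Rightarrow> ('x \<Rightarrow> 'x \<Rightarrow> real)
     \<Rightarrow> (nat \<Rightarrow> 'd set) \<Rightarrow> (nat \<Rightarrow> 'g \<Rightarrow> 'd \<Rightarrow> 'd) \<Rightarrow> ereal" where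
  "sofic_entropy G T act \<rho> D \<sigma> =
     (SUP \<kappa> \<in> {0<..}. INF \<delta> \<in> {0<..}. INF F \<in> {F. finite F \<and> F \<subseteq> carrier G}.
        limsup (\<lambda>n. ereal (1 / real (card (D n))) *
          log_enat (sep_number \<kappa> (Map T act \<rho> F \<delta> (D n) (\<sigma> n)) (rho_inf (D n) \<rho>))))"

end

theory Submission
  imports Defs
begin

text \<open>The coset space \<open>H\G\<close> is a finite set with an exact action of \<open>G\<close>, and the \<open>H\<close>-periodic
  points of \<open>X\<close> correspond to the labelings of \<open>H\G\<close> by \<open>K\<close> that show a point of \<open>X\<close> along
  every orbit (\<open>card_coset_labelings\<close>), equivalently to the exactly equivariant maps from \<open>H\G\<close>
  to \<open>X\<close>. The theorem is therefore an instance of a statement about arbitrary actions on finite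
  sets \<open>D\<close>: the entropy is the exponential growth rate of the number of such labelings, whose
  set is called \<open>Y\<close> (\<open>sofic_entropy_eq_labelings\<close>).

  Equivariant maps lie in every \<open>Map\<close>, and distinct ones are \<open>\<eta>\<close>-separated for a uniform \<open>\<eta>\<close>
  because \<open>\<rho>\<close> is generating and \<open>X\<close> is compact. This is the lower bound
  (\<open>card_Y_le_sep_number\<close>).

  For the upper bound, an approximately equivariant map \<open>\<phi>\<close> is compared with its labeling
  \<open>d \<mapsto> \<phi>(d)(1)\<close>. The two agree on a given finite window except at a small proportion of bad
  points (\<open>card_bad_le\<close>). A separated map is determined by its labeling together with a code
  recording the window patterns at the bad points. The labeling obeys the local rule of \<open>X\<close>
  except at the bad points. It is not repaired there; instead two maps with the same code are
  divided by each other. At the bad points the quotient shows the pattern of the identity, at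
  the others the pattern of a quotient of two points of \<open>X\<close>; since \<open>X\<close> is a group of finite
  type, the quotient lies in \<open>Y\<close> (\<open>label_quotient_in_Y\<close>). So a separated set has at most
  \<open>|Y|\<close> elements for each code (\<open>card_separated_le\<close>), and the number of codes grows at an
  arbitrarily small exponential rate as the density of bad points tends to \<open>0\<close>
  (\<open>sparse_codes_subexponential\<close>).\<close>

section \<open>Counting functions that are almost everywhere trivial\<close>

text \<open>A generating-function bound in place of an estimate of binomial coefficients. Give the
  symbol \<open>None\<close> weight \<open>1\<close> and every other symbol weight \<open>t\<close>, and a code the product of the
  weights of its symbols. All codes together have total weight \<open>(1 + t |Q|)^|D|\<close>, whereas a
  sparse one alone has weight at least \<open>t^(\<epsilon> |D|)\<close>.\<close>

lemma card_sparse_codes: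
  fixes \<epsilon> t :: real
  assumes "finite D" "finite Q" "0 < t" "t \<le> 1"
    and C: "C \<subseteq> D \<rightarrow>\<^sub>E insert None (Some ` Q)"
    and sparse: "\<And>c. c \<in> C \<Longrightarrow> real (card {d \<in> D. c d \<noteq> None}) \<le> \<epsilon> * real (card D)"
  shows "real (card C) \<le> t powr (- (\<epsilon> * real (card D))) * (1 + t * real (card Q)) ^ card D"
proof -
  define wt where "wt = (\<lambda>q :: 'b option. if q = None then 1 else t)"
  have fin: "finite (D \<rightarrow>\<^sub>E insert None (Some ` Q))"
    using assms by (intro finite_PiE) auto
  have weight: "t powr (\<epsilon> * real (card D)) \<le> (\<Prod>d\<in>D. wt (c d))" if "c \<in> C" for c
  proof -
    have "(\<Prod>d\<in>D. wt (c d)) = (\<Prod>d\<in>{d\<in>D. c d \<noteq> None}. t)"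
      unfolding wt_def using \<open>finite D\<close> by (intro prod.mono_neutral_cong_right) auto
    also have "\<dots> = t powr real (card {d\<in>D. c d \<noteq> None})"
      using \<open>0 < t\<close> by (simp add: powr_realpow)
    also have "\<dots> \<ge> t powr (\<epsilon> * real (card D))"
      using sparse[OF that] assms by (intro powr_mono') auto
    finally show ?thesis .
  qed
  have "real (card C) * t powr (\<epsilon> * real (card D)) = (\<Sum>c\<in>C. t powr (\<epsilon> * real (card D)))"
    by simp
  also have "\<dots> \<le> (\<Sum>c\<in>C. \<Prod>d\<in>D. wt (c d))"
    by (intro sum_mono weight)
  also have "\<dots> \<le> (\<Sum>c\<in>D \<rightarrow>\<^sub>E insert None (Some ` Q). \<Prod>d\<in>D. wt (c d))"
    using \<open>0 < t\<close> by (intro sum_mono2[OF fin C] prod_nonneg) (auto simp: wt_def)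
  also have "\<dots> = (\<Prod>d\<in>D. \<Sum>q\<in>insert None (Some ` Q). wt q)"
    using assms by (subst prod_sum_PiE) auto
  also have "(\<Sum>q\<in>insert None (Some ` Q). wt q) = 1 + t * real (card Q)"
    using \<open>finite Q\<close> by (subst sum.insert) (auto simp: wt_def sum.reindex)
  finally show ?thesis
    using \<open>0 < t\<close> by (simp add: powr_minus field_simps)
qed

text \<open>First \<open>t\<close> is chosen so small that \<open>1 + t |Q| \<le> e^(\<eta>/2)\<close>, then \<open>\<epsilon>\<close> so small that
  \<open>t^(-\<epsilon>) \<le> e^(\<eta>/2)\<close>. The density \<open>\<epsilon>\<close> depends on the alphabet only through its size and on
  \<open>D\<close> not at all, which makes the estimate uniform along a sofic approximation.\<close>

lemma sparse_codes_subexponential: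
  fixes \<eta> :: real
  assumes "0 < \<eta>"
  obtains \<epsilon> :: real where "0 < \<epsilon>"
    and "\<And>(D :: 'd set) (Q :: 'q set) C. \<lbrakk>finite D; finite Q; card Q \<le> m;
           C \<subseteq> D \<rightarrow>\<^sub>E insert None (Some ` Q);
           \<And>c. c \<in> C \<Longrightarrow> real (card {d \<in> D. c d \<noteq> None}) \<le> \<epsilon> * real (card D)\<rbrakk>
         \<Longrightarrow> real (card C) \<le> exp (\<eta> * real (card D))"
proof -
  define t where "t = min 1 (\<eta> / (2 * (real m + 1)))"
  have t: "0 < t" "t \<le> 1" "t * real m \<le> \<eta> / 2"
  proof -
    show "0 < t" "t \<le> 1" using assms by (auto simp: t_def)
    have "t * real m \<le> \<eta> / (2 * (real m + 1)) * real m"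
      by (intro mult_right_mono) (auto simp: t_def)
    also have "\<dots> \<le> \<eta> / 2" using assms by (simp add: field_simps)
    finally show "t * real m \<le> \<eta> / 2" .
  qed
  define \<epsilon> where "\<epsilon> = \<eta> / (2 * (1 - ln t))"
  have ln_t: "ln t \<le> 0" using t by simp
  have \<epsilon>: "0 < \<epsilon>" "- (\<epsilon> * ln t) \<le> \<eta> / 2"
    using assms ln_t by (auto simp: \<epsilon>_def field_simps)
  show thesis
  proof (rule that[OF \<epsilon>(1)])
    fix D :: "'d set" and Q :: "'q set" and C
    assume *: "finite D" "finite Q" "card Q \<le> m" "C \<subseteq> D \<rightarrow>\<^sub>E insert None (Some ` Q)"
      "\<And>c. c \<in> C \<Longrightarrow> real (card {d \<in> D. c d \<noteq> None}) \<le> \<epsilon> * real (card D)"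
    have "t powr (- (\<epsilon> * real (card D))) = exp (- (\<epsilon> * ln t) * real (card D))"
      using t by (simp add: powr_def algebra_simps)
    also have "\<dots> \<le> exp (\<eta> / 2 * real (card D))"
      using \<epsilon> by (intro iffD2[OF exp_le_cancel_iff] mult_right_mono) auto
    finally have choices: "t powr (- (\<epsilon> * real (card D))) \<le> exp (\<eta> / 2 * real (card D))" .
    have "(1 + t * real (card Q)) ^ card D \<le> exp (\<eta> / 2) ^ card D"
    proof (rule power_mono)
      have "t * real (card Q) \<le> t * real m" using * t by (intro mult_left_mono) auto
      hence "1 + t * real (card Q) \<le> 1 + \<eta> / 2" using t by linarith
      also have "\<dots> \<le> exp (\<eta> / 2)" by (rule exp_ge_add_one_self)
      finally show "1 + t * real (card Q) \<le> exp (\<eta> / 2)" .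
    qed (use t in auto)
    also have "exp (\<eta> / 2) ^ card D = exp (\<eta> / 2 * real (card D))"
      by (simp add: exp_of_nat_mult[symmetric] mult.commute)
    finally have patterns: "(1 + t * real (card Q)) ^ card D \<le> exp (\<eta> / 2 * real (card D))" .
    have "real (card C) \<le> t powr (- (\<epsilon> * real (card D))) * (1 + t * real (card Q)) ^ card D"
      using * t by (intro card_sparse_codes) auto
    also have "\<dots> \<le> exp (\<eta> / 2 * real (card D)) * exp (\<eta> / 2 * real (card D))"
      using t by (intro mult_mono choices patterns) auto
    finally show "real (card C) \<le> exp (\<eta> * real (card D))"
      by (simp add: exp_add[symmetric])
  qed
qed

section \<open>Algebraic subshifts of finite type\<close>

locale metric_algebraic_sft = G: group G + K: group K
  for G :: "('g, 'b) monoid_scheme" and K :: "('k, 'c) monoid_scheme" +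
  fixes X :: "('g \<Rightarrow> 'k) set" and \<rho> :: "('g \<Rightarrow> 'k) \<Rightarrow> ('g \<Rightarrow> 'k) \<Rightarrow> real"
  assumes finite_K: "finite (carrier K)"
    and algebraic: "algebraic_subshift G K X"
    and finite_type: "finite_type G K X"
    and pseudometric: "continuous_pseudometric (subtopology (config_topology G K) X) \<rho>"
    and generating: "generating G (subtopology (config_topology G K) X) (shift G) \<rho>"
begin

definition T where "T = subtopology (config_topology G K) X"

lemma X_subset: "X \<subseteq> carrier G \<rightarrow>\<^sub>E carrier K"
  using algebraic closedin_subset
  by (fastforce simp: algebraic_subshift_def subshift_def config_topology_def)

lemma topspace_T [simp]: "topspace T = X"
  using X_subset by (auto simp: T_def config_topology_def)

lemma X_closed [simp]: "x \<in> X \<Longrightarrow> h \<in> carrier G \<Longrightarrow> x h \<in> carrier K"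
  using X_subset by auto

lemma X_ext: "x \<in> X \<Longrightarrow> y \<in> X \<Longrightarrow> (\<And>h. h \<in> carrier G \<Longrightarrow> x h = y h) \<Longrightarrow> x = y"
  by (rule PiE_ext[of x "carrier G" "\<lambda>_. carrier K" y]) (use X_subset in auto)

lemma shift_X [simp]: "x \<in> X \<Longrightarrow> g \<in> carrier G \<Longrightarrow> shift G g x \<in> X"
  using algebraic by (auto simp: algebraic_subshift_def subshift_def)

lemma shift_apply [simp]: "h \<in> carrier G \<Longrightarrow> shift G g x h = x (inv\<^bsub>G\<^esub> g \<otimes>\<^bsub>G\<^esub> h)"
  by (simp add: shift_def)

lemma shift_shift:
  "g \<in> carrier G \<Longrightarrow> h \<in> carrier G \<Longrightarrow> shift G g (shift G h x) = shift G (g \<otimes>\<^bsub>G\<^esub> h) x"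
  by (auto simp: shift_def G.inv_mult_group G.m_assoc)

lemma X_subgroup: "subgroup X (product_group (carrier G) (\<lambda>_. K))"
  using algebraic by (auto simp: algebraic_subshift_def)

lemma one_in_X: "(\<lambda>h\<in>carrier G. \<one>\<^bsub>K\<^esub>) \<in> X"
  using subgroup.one_closed[OF X_subgroup] by simp

text \<open>Two points of \<open>X\<close> are compared by \<open>x\<inverse>y\<close>; this is where \<open>X\<close> being a subgroup enters.\<close>

lemma quotient_in_X:
  assumes "x \<in> X" "y \<in> X"
  shows "(\<lambda>h\<in>carrier G. inv\<^bsub>K\<^esub> x h \<otimes>\<^bsub>K\<^esub> y h) \<in> X"
proof -
  have "inv\<^bsub>product_group (carrier G) (\<lambda>_. K)\<^esub> x = (\<lambda>h\<in>carrier G. inv\<^bsub>K\<^esub> x h)"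
    using assms X_subset by (intro inv_product_group) (auto intro: K.group_axioms)
  hence "(\<lambda>h\<in>carrier G. inv\<^bsub>K\<^esub> x h) \<in> X"
    using subgroup.m_inv_closed[OF X_subgroup \<open>x \<in> X\<close>] by simp
  from subgroup.m_closed[OF X_subgroup this \<open>y \<in> X\<close>]
  show ?thesis by (simp cong: restrict_cong)
qed

lemma rho_refl: "x \<in> X \<Longrightarrow> \<rho> x x = 0"
  and rho_commute: "x \<in> X \<Longrightarrow> y \<in> X \<Longrightarrow> \<rho> x y = \<rho> y x"
  and rho_triangle: "x \<in> X \<Longrightarrow> y \<in> X \<Longrightarrow> z \<in> X \<Longrightarrow> \<rho> x z \<le> \<rho> x y + \<rho> y z"
  and rho_continuous: "continuous_map (prod_topology T T) euclideanreal (\<lambda>(x, y). \<rho> x y)"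
  using pseudometric unfolding T_def[symmetric] continuous_pseudometric_def topspace_T by blast+

lemma rho_generating:
  "x \<in> X \<Longrightarrow> y \<in> X \<Longrightarrow> x \<noteq> y \<Longrightarrow> \<exists>g\<in>carrier G. 0 < \<rho> (shift G g x) (shift G g y)"
  using generating unfolding T_def[symmetric] generating_def topspace_T by blast

text \<open>The three finitary properties of finite subsets of \<open>G\<close> through which finite type and
  compactness are used. A defining window is a set on which it suffices to test that every
  translate of a configuration looks like some point of \<open>X\<close>; testing against points of \<open>X\<close>
  instead of a list of allowed patterns makes the tests compatible with the group structure.
  Agreement on a metric window forces \<open>\<rho>\<close>-closeness. Conversely, translates by a separating
  set detect a difference at the identity uniformly, although \<open>\<rho>\<close> itself may vanish on
  distinct points.\<close>

definition defining_window :: "'g set \<Rightarrow> bool" where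
  "defining_window V \<longleftrightarrow> V \<subseteq> carrier G \<and>
     (\<forall>x \<in> carrier G \<rightarrow>\<^sub>E carrier K.
        (\<forall>g \<in> carrier G. \<exists>y\<in>X. \<forall>v\<in>V. x (g \<otimes>\<^bsub>G\<^esub> v) = y v) \<longrightarrow> x \<in> X)"

definition metric_window :: "real \<Rightarrow> 'g set \<Rightarrow> bool" where
  "metric_window \<kappa> B \<longleftrightarrow> B \<subseteq> carrier G \<and>
     (\<forall>x\<in>X. \<forall>y\<in>X. (\<forall>h\<in>B. x h = y h) \<longrightarrow> \<rho> x y < \<kappa>)"

definition separating :: "real \<Rightarrow> 'g set \<Rightarrow> bool" where
  "separating \<eta> E \<longleftrightarrow> E \<subseteq> carrier G \<and>
     (\<forall>x\<in>X. \<forall>y\<in>X. x \<one>\<^bsub>G\<^esub> \<noteq> y \<one>\<^bsub>G\<^esub> \<longrightarrow> (\<exists>g\<in>E. \<eta> \<le> \<rho> (shift G g x) (shift G g y)))"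

lemma windows_union:
  assumes "defining_window V" "metric_window \<kappa> B"
  shows "defining_window (V \<union> B)" "metric_window \<kappa> (V \<union> B)"
proof -
  have "V \<union> B \<subseteq> carrier G" using assms by (auto simp: defining_window_def metric_window_def)
  moreover have "x \<in> X" if "x \<in> carrier G \<rightarrow>\<^sub>E carrier K"
    "\<forall>g \<in> carrier G. \<exists>y\<in>X. \<forall>v\<in>V \<union> B. x (g \<otimes>\<^bsub>G\<^esub> v) = y v" for x
  proof -
    have "\<exists>y\<in>X. \<forall>v\<in>V. x (g \<otimes>\<^bsub>G\<^esub> v) = y v" if "g \<in> carrier G" for g
      using \<open>\<forall>g \<in> carrier G. _ g\<close> that by (meson UnI1)
    thus ?thesis using assms(1) that(1) unfolding defining_window_def by blast
  qed
  ultimately show "defining_window (V \<union> B)" "metric_window \<kappa> (V \<union> B)"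
    using assms(2) by (simp_all add: defining_window_def metric_window_def)
qed

text \<open>The pattern at \<open>g\<close> of the finite-type condition reads \<open>x\<close> at the places
  \<open>g\<inverse>w\<inverse>\<close> for \<open>w \<in> W\<close>, so the inverse of \<open>W\<close> is a window. That points of \<open>X\<close> only
  show patterns from \<open>P\<close> is read off at the identity.\<close>

lemma finite_defining_window:
  obtains V where "finite V" "defining_window V"
proof -
  obtain W P where W: "finite W" "W \<subseteq> carrier G"
    and X: "X = {x \<in> carrier G \<rightarrow>\<^sub>E carrier K.
      \<forall>g \<in> carrier G. \<exists>p \<in> P. \<forall>w \<in> W. shift G (w \<otimes>\<^bsub>G\<^esub> g) x \<one>\<^bsub>G\<^esub> = p w}"
    using finite_type unfolding finite_type_def by blast
  have pattern: "shift G (w \<otimes>\<^bsub>G\<^esub> g) x \<one>\<^bsub>G\<^esub> = x (inv\<^bsub>G\<^esub> g \<otimes>\<^bsub>G\<^esub> inv\<^bsub>G\<^esub> w)"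
    if "w \<in> W" "g \<in> carrier G" for w g and x :: "'g \<Rightarrow> 'k"
    using that W by (auto simp: G.inv_mult_group subset_iff)
  show thesis
  proof (rule that[of "(\<lambda>w. inv\<^bsub>G\<^esub> w) ` W"])
    show "finite ((\<lambda>w. inv\<^bsub>G\<^esub> w) ` W)" using W by simp
    show "defining_window ((\<lambda>w. inv\<^bsub>G\<^esub> w) ` W)"
      unfolding defining_window_def
    proof (intro conjI ballI impI)
      fix x :: "'g \<Rightarrow> 'k"
      assume x: "x \<in> carrier G \<rightarrow>\<^sub>E carrier K"
        and *: "\<forall>g\<in>carrier G. \<exists>y\<in>X. \<forall>v\<in>(\<lambda>w. inv\<^bsub>G\<^esub> w) ` W. x (g \<otimes>\<^bsub>G\<^esub> v) = y v"
      have "\<exists>p\<in>P. \<forall>w\<in>W. shift G (w \<otimes>\<^bsub>G\<^esub> g) x \<one>\<^bsub>G\<^esub> = p w" if g: "g \<in> carrier G" for g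
      proof -
        obtain y where y: "y \<in> X" "\<And>w. w \<in> W \<Longrightarrow> x (inv\<^bsub>G\<^esub> g \<otimes>\<^bsub>G\<^esub> inv\<^bsub>G\<^esub> w) = y (inv\<^bsub>G\<^esub> w)"
          using *[rule_format, of "inv\<^bsub>G\<^esub> g"] g by auto
        obtain p where "p \<in> P" and p: "\<And>w. w \<in> W \<Longrightarrow> shift G (w \<otimes>\<^bsub>G\<^esub> \<one>\<^bsub>G\<^esub>) y \<one>\<^bsub>G\<^esub> = p w"
          using y(1) X by blast
        have "shift G (w \<otimes>\<^bsub>G\<^esub> g) x \<one>\<^bsub>G\<^esub> = p w" if "w \<in> W" for w
          using p[OF that, unfolded pattern[OF that G.one_closed]] y(2)[OF that] that W
          unfolding pattern[OF that g] by (auto simp: subset_iff)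
        with \<open>p \<in> P\<close> show ?thesis by blast
      qed
      thus "x \<in> X" using x by (subst X) blast
    qed (use W in auto)
  qed
qed

section \<open>Uniformity from compactness\<close>

lemma compact_T: "compactin T X"
proof -
  have "compact_space (config_topology G K)"
    unfolding config_topology_def
    by (intro compact_space_product_topology[THEN iffD2] disjI2 ballI)
      (simp add: compact_space_discrete_topology finite_K)
  moreover have "closedin (config_topology G K) X"
    using algebraic by (auto simp: algebraic_subshift_def subshift_def)
  ultimately show ?thesis
    by (simp add: T_def closedin_compact_space)
qed

lemma continuous_eval:
  assumes "h \<in> carrier G"
  shows "continuous_map T (discrete_topology (carrier K)) (\<lambda>x. x h)"
  unfolding T_def config_topology_def
  using assms by (intro continuous_map_from_subtopology continuous_map_product_projection)

lemma continuous_shift: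
  assumes g: "g \<in> carrier G"
  shows "continuous_map T T (shift G g)"
proof -
  have "continuous_map T (discrete_topology (carrier K)) (\<lambda>x. shift G g x h)" if "h \<in> carrier G" for h
    using continuous_eval[of "inv\<^bsub>G\<^esub> g \<otimes>\<^bsub>G\<^esub> h"] g that by simp
  hence "continuous_map T (config_topology G K) (shift G g)"
    by (subst config_topology_def) (auto simp: continuous_map_componentwise shift_def)
  moreover have "shift G g \<in> topspace T \<rightarrow> X"
    using g by auto
  ultimately show ?thesis
    by (subst (2) T_def) (simp add: continuous_map_in_subtopology)
qed

lemma eq_at_openin:
  assumes "h \<in> carrier G" "openin (discrete_topology (carrier K \<times> carrier K)) R"
  shows "openin (prod_topology T T) {p \<in> X \<times> X. (fst p h, snd p h) \<in> R}"
proof -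
  have "continuous_map (prod_topology T T) (discrete_topology (carrier K \<times> carrier K))
          (\<lambda>p. (fst p h, snd p h))"
    unfolding prod_topology_discrete_topology
    using continuous_map_compose[OF continuous_map_fst continuous_eval[OF assms(1)]]
      continuous_map_compose[OF continuous_map_snd continuous_eval[OF assms(1)]]
    by (intro continuous_map_pairedI) (auto simp: o_def)
  from openin_continuous_map_preimage[OF this assms(2)] show ?thesis
    by simp
qed

lemma rho_shift_openin:
  assumes g: "g \<in> carrier G" and "open R"
  shows "openin (prod_topology T T) {p \<in> X \<times> X. \<rho> (shift G g (fst p)) (shift G g (snd p)) \<in> R}"
proof -
  have "continuous_map (prod_topology T T) (prod_topology T T)
          (\<lambda>p. (shift G g (fst p), shift G g (snd p)))"
    using continuous_map_compose[OF continuous_map_fst continuous_shift[OF g]]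
      continuous_map_compose[OF continuous_map_snd continuous_shift[OF g]]
    by (intro continuous_map_pairedI) (auto simp: o_def)
  from continuous_map_compose[OF this rho_continuous]
  have "continuous_map (prod_topology T T) euclideanreal
          (\<lambda>p. \<rho> (shift G g (fst p)) (shift G g (snd p)))"
    by (simp add: o_def)
  from openin_continuous_map_preimage[OF this] \<open>open R\<close> show ?thesis
    by simp
qed

lemma finite_subcover:
  assumes C: "closedin (prod_topology T T) C"
    and "\<And>i. i \<in> I \<Longrightarrow> openin (prod_topology T T) (U i)" "C \<subseteq> (\<Union>i\<in>I. U i)"
  obtains J where "finite J" "J \<subseteq> I" "C \<subseteq> (\<Union>i\<in>J. U i)"
proof -
  have "compactin (prod_topology T T) C"
    using closed_compactin[of "prod_topology T T" "X \<times> X" C] closedin_subset[OF C] C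
    by (simp add: compactin_Times compact_T)
  hence "\<exists>\<F>. finite \<F> \<and> \<F> \<subseteq> U ` I \<and> C \<subseteq> \<Union>\<F>"
    by (rule compactinD) (use assms in auto)
  then obtain J where "finite J" "J \<subseteq> I" "C \<subseteq> \<Union>(U ` J)"
    by (metis finite_subset_image)
  thus thesis by (rule that)
qed

text \<open>The pairs that differ at the identity form a compact set, covered by the open sets of pairs
  with \<open>\<rho> (g x) (g y) > 1/(n+1)\<close> because \<open>\<rho>\<close> is generating. A finite subcover gives a finite
  set of \<open>g\<close> and a largest \<open>n\<close>, hence a uniform \<open>\<eta>\<close>.\<close>

lemma uniformly_generating:
  obtains E \<eta> where "finite E" "0 < \<eta>" "separating \<eta> E"
proof -
  define C where "C = {p \<in> X \<times> X. (fst p \<one>\<^bsub>G\<^esub>, snd p \<one>\<^bsub>G\<^esub>) \<in> carrier K \<times> carrier K - Id}"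
  define U where "U = (\<lambda>(g, n::nat). {p \<in> X \<times> X.
    \<rho> (shift G g (fst p)) (shift G g (snd p)) \<in> {1 / (real n + 1)<..}})"
  have "topspace (prod_topology T T) - C
      = {p \<in> X \<times> X. (fst p \<one>\<^bsub>G\<^esub>, snd p \<one>\<^bsub>G\<^esub>) \<in> (carrier K \<times> carrier K) \<inter> Id}"
    by (auto simp: C_def)
  also have "openin (prod_topology T T) \<dots>"
    by (rule eq_at_openin) auto
  finally have "closedin (prod_topology T T) C" by (auto simp: closedin_def C_def)
  moreover have "openin (prod_topology T T) (U i)" if "i \<in> carrier G \<times> UNIV" for i
    using that rho_shift_openin[of "fst i" "{1 / (real (snd i) + 1)<..}"]
    by (simp add: U_def case_prod_unfold mem_Times_iff)
  moreover have "C \<subseteq> (\<Union>i\<in>carrier G \<times> UNIV. U i)"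
  proof
    fix p assume p: "p \<in> C"
    obtain x y where xy: "p = (x, y)" by fastforce
    have "x \<in> X" "y \<in> X" "x \<noteq> y" using p by (auto simp: C_def xy)
    then obtain g where g: "g \<in> carrier G" "0 < \<rho> (shift G g x) (shift G g y)"
      using rho_generating by blast
    then obtain n where "1 / (real n + 1) < \<rho> (shift G g x) (shift G g y)"
      using reals_Archimedean[OF g(2)] by (auto simp: inverse_eq_divide add.commute)
    hence "p \<in> U (g, n)" using \<open>x \<in> X\<close> \<open>y \<in> X\<close> by (simp add: U_def xy)
    thus "p \<in> (\<Union>i\<in>carrier G \<times> UNIV. U i)" using g by blast
  qed
  ultimately obtain I where I: "finite I" "I \<subseteq> carrier G \<times> UNIV" "C \<subseteq> (\<Union>i\<in>I. U i)"
    by (rule finite_subcover)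
  define \<eta> where "\<eta> = 1 / (real (Max (insert 0 (snd ` I))) + 1)"
  have "separating \<eta> (fst ` I)"
    unfolding separating_def
  proof (intro conjI ballI impI)
    fix x y assume xy: "x \<in> X" "y \<in> X" "x \<one>\<^bsub>G\<^esub> \<noteq> y \<one>\<^bsub>G\<^esub>"
    hence "(x, y) \<in> C" by (auto simp: C_def)
    then obtain i where "i \<in> I" "(x, y) \<in> U i" using I(3) by blast
    moreover obtain g n where "i = (g, n)" by (cases i)
    ultimately have gn: "(g, n) \<in> I" "(x, y) \<in> U (g, n)" by simp_all
    hence far: "1 / (real n + 1) < \<rho> (shift G g x) (shift G g y)" by (simp add: U_def)
    have "n \<in> insert 0 (snd ` I)" using gn(1) by force
    hence "n \<le> Max (insert 0 (snd ` I))" using I(1) by (intro Max_ge) auto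
    hence "\<eta> \<le> 1 / (real n + 1)" unfolding \<eta>_def by (intro divide_left_mono) auto
    thus "\<exists>g\<in>fst ` I. \<eta> \<le> \<rho> (shift G g x) (shift G g y)"
      using far gn(1) by (intro bexI[of _ g]) (linarith, force)
  next
    show "fst ` I \<subseteq> carrier G" using I(2) by auto
  qed
  thus thesis
    using I(1) by (intro that) (simp_all add: \<eta>_def add_pos_nonneg)
qed

text \<open>The pairs at distance at least \<open>\<kappa>\<close> form a compact set. It misses the diagonal, so
  the open sets of pairs that differ at a given place cover it.\<close>

lemma finite_metric_window:
  assumes "0 < \<kappa>"
  obtains B where "finite B" "metric_window \<kappa> B"
proof -
  define near where
    "near = {p \<in> X \<times> X. \<rho> (shift G \<one>\<^bsub>G\<^esub> (fst p)) (shift G \<one>\<^bsub>G\<^esub> (snd p)) \<in> {..<\<kappa>}}"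
  define U where "U = (\<lambda>h. {p \<in> X \<times> X. (fst p h, snd p h) \<in> carrier K \<times> carrier K - Id})"
  have shift_one: "shift G \<one>\<^bsub>G\<^esub> x = x" if "x \<in> X" for x
    by (rule X_ext) (use that in auto)
  hence near: "(x, y) \<in> near \<longleftrightarrow> \<rho> x y < \<kappa>" if "x \<in> X" "y \<in> X" for x y
    using that by (simp add: near_def)
  have "closedin (prod_topology T T) (topspace (prod_topology T T) - near)"
    unfolding near_def by (intro closedin_diff closedin_topspace rho_shift_openin) auto
  moreover have "openin (prod_topology T T) (U h)" if "h \<in> carrier G" for h
    unfolding U_def using that by (rule eq_at_openin) auto
  moreover have "topspace (prod_topology T T) - near \<subseteq> (\<Union>h\<in>carrier G. U h)"
  proof
    fix p assume p: "p \<in> topspace (prod_topology T T) - near"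
    obtain x y where xy: "p = (x, y)" by fastforce
    have X: "x \<in> X" "y \<in> X" using p by (auto simp: xy)
    have "x \<noteq> y"
      using p X assms rho_refl[of x] by (auto simp: xy near)
    then obtain h where "h \<in> carrier G" "x h \<noteq> y h" using X_ext X by blast
    thus "p \<in> (\<Union>h\<in>carrier G. U h)" using X by (auto simp: U_def xy)
  qed
  ultimately obtain B where B: "finite B" "B \<subseteq> carrier G"
      "topspace (prod_topology T T) - near \<subseteq> (\<Union>h\<in>B. U h)"
    by (rule finite_subcover)
  have "metric_window \<kappa> B"
    unfolding metric_window_def
  proof (intro conjI ballI impI)
    fix x y assume xy: "x \<in> X" "y \<in> X" and agree: "\<forall>h\<in>B. x h = y h"
    hence "(x, y) \<notin> (\<Union>h\<in>B. U h)" by (auto simp: U_def)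
    hence "(x, y) \<in> near" using B(3) xy by auto
    thus "\<rho> x y < \<kappa>" using xy by (simp add: near)
  qed (rule B)
  with B(1) show thesis by (rule that)
qed

end


section \<open>Labelings of a finite \<open>G\<close>-set\<close>

text \<open>The configuration seen from \<open>d\<close> by reading the labels \<open>a\<close> along the orbit. The inverse
  makes the map from \<open>d\<close> to its configuration equivariant, so that labelings all of whose
  configurations lie in \<open>X\<close> are the same as equivariant maps from \<open>D\<close> to \<open>X\<close>.\<close>

definition orbit_config ::
  "('g, 'b) monoid_scheme \<Rightarrow> ('g \<Rightarrow> 'd \<Rightarrow> 'd) \<Rightarrow> ('d \<Rightarrow> 'k) \<Rightarrow> 'd \<Rightarrow> ('g \<Rightarrow> 'k)" where
  "orbit_config G s a d = (\<lambda>h\<in>carrier G. a (s (inv\<^bsub>G\<^esub> h) d))"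

definition labelings ::
  "('g, 'b) monoid_scheme \<Rightarrow> ('k, 'c) monoid_scheme \<Rightarrow> ('g \<Rightarrow> 'k) set \<Rightarrow> 'd set
     \<Rightarrow> ('g \<Rightarrow> 'd \<Rightarrow> 'd) \<Rightarrow> ('d \<Rightarrow> 'k) set" where
  "labelings G K X D s = {a \<in> D \<rightarrow>\<^sub>E carrier K. \<forall>d\<in>D. orbit_config G s a d \<in> X}"

locale finite_model = metric_algebraic_sft G K X \<rho>
  for G :: "('g, 'b) monoid_scheme" and K :: "('k, 'c) monoid_scheme"
    and X :: "('g \<Rightarrow> 'k) set" and \<rho> :: "('g \<Rightarrow> 'k) \<Rightarrow> ('g \<Rightarrow> 'k) \<Rightarrow> real" +
  fixes D :: "'d set" and s :: "'g \<Rightarrow> 'd \<Rightarrow> 'd"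
  assumes finite_D: "finite D" and D_nonempty: "D \<noteq> {}"
    and s_closed [simp]: "g \<in> carrier G \<Longrightarrow> d \<in> D \<Longrightarrow> s g d \<in> D"
    and s_one: "d \<in> D \<Longrightarrow> s \<one>\<^bsub>G\<^esub> d = d"
    and s_mult: "g \<in> carrier G \<Longrightarrow> h \<in> carrier G \<Longrightarrow> d \<in> D \<Longrightarrow> s (g \<otimes>\<^bsub>G\<^esub> h) d = s g (s h d)"
begin

abbreviation "config \<equiv> orbit_config G s"
abbreviation "Y \<equiv> labelings G K X D s"

lemma card_D_pos: "0 < card D"
  using finite_D D_nonempty by (simp add: card_gt_0_iff)

lemma config_apply [simp]: "h \<in> carrier G \<Longrightarrow> config a d h = a (s (inv\<^bsub>G\<^esub> h) d)"
  by (simp add: orbit_config_def)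

lemma config_equivariant:
  assumes "g \<in> carrier G" "d \<in> D"
  shows "config a (s g d) = shift G g (config a d)"
  using assms by (auto simp: orbit_config_def shift_def s_mult G.inv_mult_group)

lemma inj_on_s:
  assumes "g \<in> carrier G"
  shows "inj_on (s g) D"
  by (rule inj_on_inverseI[where g = "s (inv\<^bsub>G\<^esub> g)"])
    (use assms in \<open>simp add: s_mult[symmetric] s_one\<close>)

lemma finite_Y: "finite Y"
  by (rule finite_subset[of _ "D \<rightarrow>\<^sub>E carrier K"])
    (auto simp: labelings_def finite_D finite_K intro: finite_PiE)

lemma Y_nonempty: "Y \<noteq> {}"
proof -
  have "config (\<lambda>d\<in>D. \<one>\<^bsub>K\<^esub>) d = (\<lambda>h\<in>carrier G. \<one>\<^bsub>K\<^esub>)" if "d \<in> D" for d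
    using that by (auto simp: orbit_config_def)
  hence "(\<lambda>d\<in>D. \<one>\<^bsub>K\<^esub>) \<in> Y"
    by (auto simp: labelings_def one_in_X)
  thus ?thesis by blast
qed

lemma card_Y_pos: "0 < card Y"
  using finite_Y Y_nonempty by (simp add: card_gt_0_iff)

lemma rho_inf_ge_iff: "\<kappa> \<le> rho_inf D \<rho> \<phi> \<psi> \<longleftrightarrow> (\<exists>d\<in>D. \<kappa> \<le> \<rho> (\<phi> d) (\<psi> d))"
  unfolding rho_inf_def using finite_D D_nonempty by (subst Max_ge_iff) auto

text \<open>Sending a labeling to its configurations gives an exactly equivariant map, which lies in
  \<open>Map\<close> for every \<open>\<delta>\<close> and \<open>F\<close>. If two labelings differ at \<open>d\<close>, their configurations at \<open>d\<close>
  differ at the identity, hence become \<open>\<eta>\<close>-apart after some \<open>g \<in> E\<close>; by equivariance this is a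
  distance of \<open>\<eta>\<close> at the point \<open>s g d\<close> of \<open>D\<close>.\<close>

lemma card_Y_le_sep_number:
  assumes "0 < \<delta>" "F \<subseteq> carrier G"
    and E: "separating \<eta> E"
  shows "enat (card Y) \<le> sep_number \<eta> (Map T (shift G) \<rho> F \<delta> D s) (rho_inf D \<rho>)"
proof -
  define orb where "orb = (\<lambda>a :: 'd \<Rightarrow> 'k. \<lambda>d\<in>D. config a d)"
  have Y: "a d \<in> carrier K" "config a d \<in> X" if "a \<in> Y" "d \<in> D" for a d
    using that by (auto simp: labelings_def)
  have sep: "\<eta> \<le> rho_inf D \<rho> (orb a) (orb b)" if ab: "a \<in> Y" "b \<in> Y" "a \<noteq> b" for a b
  proof -
    from ab obtain d where d: "d \<in> D" "a d \<noteq> b d"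
      by (auto simp: labelings_def fun_eq_iff PiE_iff extensional_def) metis
    obtain g where g: "g \<in> E" "\<eta> \<le> \<rho> (shift G g (config a d)) (shift G g (config b d))"
      using E[unfolded separating_def] Y[OF ab(1) d(1)] Y[OF ab(2) d(1)] d
      by (metis config_apply G.one_closed G.inv_one s_one)
    moreover have "g \<in> carrier G" using g(1) E by (auto simp: separating_def)
    ultimately show ?thesis
      unfolding rho_inf_ge_iff orb_def using d
      by (intro bexI[of _ "s g d"]) (auto simp: config_equivariant)
  qed
  have inj: "inj_on orb Y"
  proof (rule inj_onI, rule ext)
    fix a b d assume ab: "a \<in> Y" "b \<in> Y" "orb a = orb b"
    show "a d = b d"
    proof (cases "d \<in> D")
      case True
      hence "config a d \<one>\<^bsub>G\<^esub> = config b d \<one>\<^bsub>G\<^esub>" using ab(3) by (metis orb_def restrict_apply')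
      thus ?thesis using True by (simp add: s_one)
    qed (use ab in \<open>auto simp: labelings_def PiE_iff extensional_def\<close>)
  qed
  have "orb a \<in> Map T (shift G) \<rho> F \<delta> D s" if "a \<in> Y" for a
  proof -
    have "rho2 D \<rho> (orb a \<circ> s f) (\<lambda>d. shift G f (orb a d)) = 0" if "f \<in> F" for f
    proof -
      have "\<rho> ((orb a \<circ> s f) d) (shift G f (orb a d)) = 0" if "d \<in> D" for d
        using that \<open>f \<in> F\<close> \<open>a \<in> Y\<close> assms
        by (auto simp: orb_def config_equivariant subset_iff Y intro!: rho_refl)
      thus ?thesis by (simp add: rho2_def)
    qed
    thus ?thesis using that assms by (auto simp: Map_def orb_def Y)
  qed
  hence "enat (card (orb ` Y)) \<le> sep_number \<eta> (Map T (shift G) \<rho> F \<delta> D s) (rho_inf D \<rho>)"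
    unfolding sep_number_def using sep finite_Y by (intro SUP_upper) auto
  thus ?thesis by (simp add: card_image[OF inj])
qed

section \<open>Approximately equivariant maps\<close>

definition label :: "('d \<Rightarrow> 'g \<Rightarrow> 'k) \<Rightarrow> 'd \<Rightarrow> 'k" where
  "label \<phi> = (\<lambda>d\<in>D. \<phi> d \<one>\<^bsub>G\<^esub>)"

text \<open>The points where \<open>\<phi>\<close> and the configuration of its own labeling disagree on \<open>U\<close>, that
  is, where the failure of \<open>\<phi>\<close> to be equivariant is visible.\<close>

definition bad :: "'g set \<Rightarrow> ('d \<Rightarrow> 'g \<Rightarrow> 'k) \<Rightarrow> 'd set" where
  "bad U \<phi> = {d \<in> D. \<exists>u\<in>U. config (label \<phi>) d u \<noteq> \<phi> d u}"

text \<open>What has to be remembered about \<open>\<phi>\<close> beyond an element of \<open>Y\<close>: its bad points, and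
  at each of them the window pattern of the labeling and that of \<open>\<phi>\<close>.\<close>

definition code :: "'g set \<Rightarrow> ('d \<Rightarrow> 'g \<Rightarrow> 'k) \<Rightarrow> 'd \<Rightarrow> (('g \<Rightarrow> 'k) \<times> ('g \<Rightarrow> 'k)) option" where
  "code U \<phi> = (\<lambda>d\<in>D. if d \<in> bad U \<phi>
     then Some (restrict (config (label \<phi>) d) U, restrict (\<phi> d) U) else None)"

lemma label_closed: "\<phi> \<in> D \<rightarrow>\<^sub>E X \<Longrightarrow> d \<in> D \<Longrightarrow> label \<phi> d \<in> carrier K"
  using PiE_mem[of \<phi> D "\<lambda>_. X" d] by (simp add: label_def)

lemma code_in_PiE:
  assumes "\<phi> \<in> D \<rightarrow>\<^sub>E X" "U \<subseteq> carrier G"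
  shows "code U \<phi> \<in> D \<rightarrow>\<^sub>E insert None (Some ` ((U \<rightarrow>\<^sub>E carrier K) \<times> (U \<rightarrow>\<^sub>E carrier K)))"
proof -
  have "restrict (config (label \<phi>) d) U \<in> U \<rightarrow>\<^sub>E carrier K" "restrict (\<phi> d) U \<in> U \<rightarrow>\<^sub>E carrier K"
    if "d \<in> D" for d
    using assms that label_closed[OF assms(1)] PiE_mem[OF assms(1) that] by (auto simp: subset_iff)
  thus ?thesis by (auto simp: code_def)
qed

lemma code_support: "{d \<in> D. code U \<phi> d \<noteq> None} = bad U \<phi>"
  by (auto simp: code_def bad_def)

lemma code_eqD:
  assumes "code U \<phi> = code U \<psi>"
  shows "bad U \<phi> = bad U \<psi>"
    and "d \<in> bad U \<phi> \<Longrightarrow> u \<in> U \<Longrightarrow> config (label \<phi>) d u = config (label \<psi>) d u"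
    and "d \<in> bad U \<phi> \<Longrightarrow> u \<in> U \<Longrightarrow> \<phi> d u = \<psi> d u"
proof -
  show bad: "bad U \<phi> = bad U \<psi>"
    using assms by (simp add: code_support[symmetric])
  assume d: "d \<in> bad U \<phi>" and u: "u \<in> U"
  have "d \<in> D" using d by (auto simp: bad_def)
  hence "restrict (config (label \<phi>) d) U = restrict (config (label \<psi>) d) U"
      "restrict (\<phi> d) U = restrict (\<psi> d) U"
    using fun_cong[OF assms, of d] d bad by (auto simp: code_def)
  thus "config (label \<phi>) d u = config (label \<psi>) d u" "\<phi> d u = \<psi> d u"
    using u by (metis restrict_apply')+
qed

text \<open>At a bad point the two labelings have the same pattern, so the quotient shows the pattern of
  the identity configuration. At any other point they show the patterns of the points
  \<open>\<phi>(d)\<close> and \<open>\<psi>(d)\<close> of \<open>X\<close>, so the quotient shows the pattern of \<open>\<phi>(d)\<inverse>\<psi>(d) \<in> X\<close>. Hence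
  the quotient satisfies the local rule everywhere, even though neither labeling need do so.\<close>

lemma label_quotient_in_Y:
  assumes window: "defining_window U"
    and \<phi>: "\<phi> \<in> D \<rightarrow>\<^sub>E X" and \<psi>: "\<psi> \<in> D \<rightarrow>\<^sub>E X" and code: "code U \<phi> = code U \<psi>"
  shows "(\<lambda>d\<in>D. inv\<^bsub>K\<^esub> label \<phi> d \<otimes>\<^bsub>K\<^esub> label \<psi> d) \<in> Y" (is "?b \<in> Y")
proof -
  have U: "U \<subseteq> carrier G" using window by (simp add: defining_window_def)
  have "config ?b d \<in> X" if d: "d \<in> D" for d
  proof (rule window[unfolded defining_window_def, THEN conjunct2, rule_format])
    show "config ?b d \<in> carrier G \<rightarrow>\<^sub>E carrier K"
      using d \<phi> \<psi> by (auto simp: orbit_config_def label_closed)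
    fix g assume g: "g \<in> carrier G"
    \<comment> \<open>Reading the configuration at \<open>d\<close> around \<open>g\<close> is reading the one at \<open>g\<inverse>d\<close>
      around the identity.\<close>
    define d' where "d' = s (inv\<^bsub>G\<^esub> g) d"
    have d': "d' \<in> D" using d g by (simp add: d'_def)
    have b: "config ?b d (g \<otimes>\<^bsub>G\<^esub> u)
        = inv\<^bsub>K\<^esub> config (label \<phi>) d' u \<otimes>\<^bsub>K\<^esub> config (label \<psi>) d' u" if "u \<in> U" for u
      using that U d g by (auto simp: d'_def G.inv_mult_group s_mult subset_iff)
    show "\<exists>y\<in>X. \<forall>u\<in>U. config ?b d (g \<otimes>\<^bsub>G\<^esub> u) = y u"
    proof (cases "d' \<in> bad U \<phi>")
      case True
      have "config ?b d (g \<otimes>\<^bsub>G\<^esub> u) = \<one>\<^bsub>K\<^esub>" if "u \<in> U" for u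
        using b[OF that] code_eqD(2)[OF code True that] that U d' label_closed[OF \<psi>]
        by (auto simp: subset_iff)
      thus ?thesis using U by (intro bexI[OF _ one_in_X]) auto
    next
      case False
      hence "config (label \<phi>) d' u = \<phi> d' u" "config (label \<psi>) d' u = \<psi> d' u" if "u \<in> U" for u
        using that d' code_eqD(1)[OF code] by (auto simp: bad_def)
      hence "\<forall>u\<in>U. config ?b d (g \<otimes>\<^bsub>G\<^esub> u) = (\<lambda>h\<in>carrier G. inv\<^bsub>K\<^esub> \<phi> d' h \<otimes>\<^bsub>K\<^esub> \<psi> d' h) u"
        using b U by (simp add: subset_iff del: config_apply)
      thus ?thesis using quotient_in_X[of "\<phi> d'" "\<psi> d'"] \<phi> \<psi> d' by blast
    qed
  qed
  thus ?thesis using \<phi> \<psi> by (auto simp: labelings_def label_closed)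
qed

text \<open>Away from the bad points \<open>\<phi>(d)\<close> can be read off from the labeling on the window, at the
  bad points it is part of the code.\<close>

lemma separated_determined_by_label:
  assumes close: "metric_window \<kappa> U"
    and \<phi>: "\<phi> \<in> D \<rightarrow>\<^sub>E X" and \<psi>: "\<psi> \<in> D \<rightarrow>\<^sub>E X" and code: "code U \<phi> = code U \<psi>"
    and label: "label \<phi> = label \<psi>"
  shows "\<not> \<kappa> \<le> rho_inf D \<rho> \<phi> \<psi>"
proof -
  have "\<phi> d u = \<psi> d u" if "d \<in> D" "u \<in> U" for d u
  proof (cases "d \<in> bad U \<phi>")
    case True
    thus ?thesis using code_eqD(3)[OF code] that by blast
  next
    case False
    hence "config (label \<phi>) d u = \<phi> d u" "config (label \<psi>) d u = \<psi> d u"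
      using code_eqD(1)[OF code] that by (auto simp: bad_def simp del: config_apply)
    thus ?thesis using label by simp
  qed
  hence "\<rho> (\<phi> d) (\<psi> d) < \<kappa>" if "d \<in> D" for d
    using close PiE_mem[OF \<phi> that] PiE_mem[OF \<psi> that] that by (simp add: metric_window_def)
  thus ?thesis by (auto simp: rho_inf_ge_iff not_le)
qed

text \<open>Among the maps with a given code fix one, \<open>\<phi>\<close>. The others are determined by their labeling,
  hence by the quotient of that labeling by the one of \<open>\<phi>\<close>, which is an element of \<open>Y\<close>.\<close>

lemma card_separated_le:
  assumes window: "defining_window U"
    and close: "metric_window \<kappa> U"
    and A: "finite A" "A \<subseteq> D \<rightarrow>\<^sub>E X"
    and sep: "\<And>\<phi> \<psi>. \<phi> \<in> A \<Longrightarrow> \<psi> \<in> A \<Longrightarrow> \<phi> \<noteq> \<psi> \<Longrightarrow> \<kappa> \<le> rho_inf D \<rho> \<phi> \<psi>"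
  shows "card A \<le> card (code U ` A) * card Y"
proof -
  have "card {\<psi> \<in> A. code U \<psi> = c} \<le> card Y" if c: "c \<in> code U ` A" for c
  proof -
    obtain \<phi> where \<phi>: "\<phi> \<in> A" "c = code U \<phi>" using c by blast
    let ?q = "\<lambda>\<psi>. \<lambda>d\<in>D. inv\<^bsub>K\<^esub> label \<phi> d \<otimes>\<^bsub>K\<^esub> label \<psi> d"
    show ?thesis
    proof (rule card_inj_on_le[where f = ?q])
      have "?q \<psi> \<in> Y" if "\<psi> \<in> A" "code U \<psi> = c" for \<psi>
        using A(2) \<phi> that by (intro label_quotient_in_Y[OF window]) (simp_all add: subset_iff)
      thus "?q ` {\<psi> \<in> A. code U \<psi> = c} \<subseteq> Y" by blast
      show "inj_on ?q {\<psi> \<in> A. code U \<psi> = c}"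
      proof (rule inj_onI, rule ccontr)
        fix \<psi> \<psi>' assume "\<psi> \<in> {\<psi> \<in> A. code U \<psi> = c}" "\<psi>' \<in> {\<psi> \<in> A. code U \<psi> = c}"
          and q: "?q \<psi> = ?q \<psi>'" and neq: "\<psi> \<noteq> \<psi>'"
        hence mem: "\<psi> \<in> A" "\<psi>' \<in> A" and code: "code U \<psi> = code U \<psi>'" by simp_all
        have PiE: "\<phi> \<in> D \<rightarrow>\<^sub>E X" "\<psi> \<in> D \<rightarrow>\<^sub>E X" "\<psi>' \<in> D \<rightarrow>\<^sub>E X"
          using A(2) mem \<phi>(1) by blast+
        have "label \<psi> d = label \<psi>' d" for d
        proof (cases "d \<in> D")
          case True
          hence "inv\<^bsub>K\<^esub> label \<phi> d \<otimes>\<^bsub>K\<^esub> label \<psi> d = inv\<^bsub>K\<^esub> label \<phi> d \<otimes>\<^bsub>K\<^esub> label \<psi>' d"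
            using fun_cong[OF q, of d] by simp
          thus ?thesis
            using PiE[THEN label_closed, OF True] by simp
        qed (simp add: label_def)
        hence "label \<psi> = label \<psi>'" by (rule ext)
        thus False
          using separated_determined_by_label[OF close PiE(2,3) code] sep[OF mem neq] by blast
      qed
    qed (rule finite_Y)
  qed
  hence "(\<Sum>c\<in>code U ` A. card {\<psi> \<in> A. code U \<psi> = c}) \<le> card (code U ` A) * card Y"
    using sum_bounded_above[of "code U ` A" "\<lambda>c. card {\<psi> \<in> A. code U \<psi> = c}" "card Y"] by simp
  thus ?thesis
    using sum.image_gen[OF A(1), of "\<lambda>_. 1 :: nat" "code U"] by simp
qed

text \<open>Chebyshev's inequality: a small quadratic mean allows large defects only at few points.\<close>

lemma card_defect_le:
  assumes \<phi>: "\<phi> \<in> Map T (shift G) \<rho> F \<delta> D s" and f: "f \<in> F" and "0 < \<eta>"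
  shows "real (card {d \<in> D. \<eta> \<le> \<rho> (\<phi> (s f d)) (shift G f (\<phi> d))}) \<le> (\<delta> / \<eta>)\<^sup>2 * real (card D)"
    (is "real (card ?B) \<le> _")
proof -
  let ?r = "\<lambda>d. (\<rho> ((\<phi> \<circ> s f) d) (shift G f (\<phi> d)))\<^sup>2"
  have "real (card ?B) * \<eta>\<^sup>2 = (\<Sum>d\<in>?B. \<eta>\<^sup>2)" by simp
  also have "\<dots> \<le> (\<Sum>d\<in>?B. ?r d)"
    using \<open>0 < \<eta>\<close> by (intro sum_mono power_mono) auto
  also have "\<dots> \<le> (\<Sum>d\<in>D. ?r d)"
    by (intro sum_mono2 finite_D) auto
  also have "\<dots> = real (card D) * (rho2 D \<rho> (\<phi> \<circ> s f) (\<lambda>d. shift G f (\<phi> d)))\<^sup>2"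
    using card_D_pos by (simp add: rho2_def sum_nonneg)
  also have "\<dots> \<le> real (card D) * \<delta>\<^sup>2"
    using \<phi> f by (intro mult_left_mono power_mono) (auto simp: Map_def rho2_def less_imp_le intro!: divide_nonneg_nonneg sum_nonneg)
  finally show ?thesis
    using \<open>0 < \<eta>\<close> by (simp add: power_divide field_simps)
qed

text \<open>If \<open>d\<close> is bad, witnessed by \<open>u = w\<inverse>\<close>, then \<open>\<phi>(w d)\<close> and \<open>w \<phi>(d)\<close> differ at the identity,
  so some \<open>g \<in> E\<close> moves them to distance at least \<open>\<eta>\<close>. Both \<open>g \<phi>(w d)\<close> and \<open>g w \<phi>(d)\<close> are
  compared to \<open>\<phi>(g w d)\<close>: one of the two distances is at least \<open>\<eta>/2\<close>, which is a defect of
  \<open>\<phi>\<close> under \<open>g\<close> at \<open>w d\<close> or under \<open>g w\<close> at \<open>d\<close>. Each pair \<open>(u, g)\<close> contributes two sets of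
  density at most \<open>(2\<delta>/\<eta>)\<^sup>2\<close>, whence the factor \<open>8\<close>.\<close>

lemma card_bad_le:
  assumes U: "finite U" "U \<subseteq> carrier G" and "0 < \<eta>"
    and "finite E" and separating: "separating \<eta> E"
    and F: "E \<subseteq> F" "\<And>g u. g \<in> E \<Longrightarrow> u \<in> U \<Longrightarrow> g \<otimes>\<^bsub>G\<^esub> inv\<^bsub>G\<^esub> u \<in> F"
    and \<phi>: "\<phi> \<in> Map T (shift G) \<rho> F \<delta> D s"
  shows "real (card (bad U \<phi>)) \<le> real (card U * card E) * (8 * (\<delta> / \<eta>)\<^sup>2 * real (card D))"
proof -
  have E: "finite E" "E \<subseteq> carrier G"
    using \<open>finite E\<close> separating by (auto simp: separating_def)
  have \<phi>X: "\<phi> d \<in> X" if "d \<in> D" for d using \<phi> that by (auto simp: Map_def)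
  define defect where "defect = (\<lambda>f. {d \<in> D. \<eta> / 2 \<le> \<rho> (\<phi> (s f d)) (shift G f (\<phi> d))})"
  define shifted where "shifted = (\<lambda>w g. {d \<in> D. s w d \<in> defect g})"
  have fin: "finite (defect f)" "finite (shifted w f)" for w f
    using finite_D by (auto simp: defect_def shifted_def)
  have defect: "real (card (defect f)) \<le> 4 * (\<delta> / \<eta>)\<^sup>2 * real (card D)" if "f \<in> F" for f
    using card_defect_le[OF \<phi> that, of "\<eta> / 2"] \<open>0 < \<eta>\<close>
    by (simp add: defect_def power_divide mult.commute)
  have shifted: "card (shifted w g) \<le> card (defect g)" if "w \<in> carrier G" for w g
    by (rule card_inj_on_le[of "s w"])
      (use that fin in \<open>auto simp: shifted_def intro: inj_on_subset[OF inj_on_s]\<close>)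
  have "bad U \<phi> \<subseteq> (\<Union>(u, g)\<in>U \<times> E. shifted (inv\<^bsub>G\<^esub> u) g \<union> defect (g \<otimes>\<^bsub>G\<^esub> inv\<^bsub>G\<^esub> u))"
  proof
    fix d assume "d \<in> bad U \<phi>"
    then obtain u where u: "u \<in> U" and d: "d \<in> D" and neq: "config (label \<phi>) d u \<noteq> \<phi> d u"
      by (auto simp: bad_def)
    define w where "w = inv\<^bsub>G\<^esub> u"
    have w: "w \<in> carrier G" "s w d \<in> D" using u U d by (auto simp: w_def)
    have "\<phi> (s w d) \<one>\<^bsub>G\<^esub> \<noteq> shift G w (\<phi> d) \<one>\<^bsub>G\<^esub>"
      using neq u U w d by (auto simp: w_def label_def)
    then obtain g where g: "g \<in> E" "\<eta> \<le> \<rho> (shift G g (\<phi> (s w d))) (shift G g (shift G w (\<phi> d)))"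
      using separating \<phi>X[OF w(2)] shift_X[OF \<phi>X[OF d] w(1)] unfolding separating_def by blast
    have gG: "g \<in> carrier G" using g E by auto
    have "\<eta> \<le> \<rho> (shift G g (\<phi> (s w d))) (shift G (g \<otimes>\<^bsub>G\<^esub> w) (\<phi> d))"
      using g w gG by (simp add: shift_shift)
    also have "\<dots> \<le> \<rho> (shift G g (\<phi> (s w d))) (\<phi> (s (g \<otimes>\<^bsub>G\<^esub> w) d))
        + \<rho> (\<phi> (s (g \<otimes>\<^bsub>G\<^esub> w) d)) (shift G (g \<otimes>\<^bsub>G\<^esub> w) (\<phi> d))"
      using gG w d by (intro rho_triangle shift_X \<phi>X) simp_all
    also have "\<rho> (shift G g (\<phi> (s w d))) (\<phi> (s (g \<otimes>\<^bsub>G\<^esub> w) d))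
        = \<rho> (\<phi> (s g (s w d))) (shift G g (\<phi> (s w d)))"
      using gG w d by (subst rho_commute) (simp_all add: s_mult \<phi>X)
    finally have "d \<in> shifted w g \<or> d \<in> defect (g \<otimes>\<^bsub>G\<^esub> w)"
      using d w by (auto simp: shifted_def defect_def)
    thus "d \<in> (\<Union>(u, g)\<in>U \<times> E. shifted (inv\<^bsub>G\<^esub> u) g \<union> defect (g \<otimes>\<^bsub>G\<^esub> inv\<^bsub>G\<^esub> u))"
      using u g(1) by (auto simp: w_def)
  qed
  hence "card (bad U \<phi>)
      \<le> card (\<Union>(u, g)\<in>U \<times> E. shifted (inv\<^bsub>G\<^esub> u) g \<union> defect (g \<otimes>\<^bsub>G\<^esub> inv\<^bsub>G\<^esub> u))"
    using E U fin by (intro card_mono) auto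
  also have "\<dots> \<le> (\<Sum>(u, g)\<in>U \<times> E. card (shifted (inv\<^bsub>G\<^esub> u) g \<union> defect (g \<otimes>\<^bsub>G\<^esub> inv\<^bsub>G\<^esub> u)))"
    using E U by (intro order_trans[OF card_UN_le]) (auto simp: case_prod_unfold)
  finally have "real (card (bad U \<phi>))
      \<le> (\<Sum>(u, g)\<in>U \<times> E. real (card (shifted (inv\<^bsub>G\<^esub> u) g \<union> defect (g \<otimes>\<^bsub>G\<^esub> inv\<^bsub>G\<^esub> u))))"
    by (simp add: case_prod_unfold flip: of_nat_sum)
  also have "\<dots> \<le> real (card (U \<times> E)) * (8 * (\<delta> / \<eta>)\<^sup>2 * real (card D))"
  proof (rule sum_bounded_above, clarify)
    fix u g assume ug: "u \<in> U" "g \<in> E"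
    have "card (shifted (inv\<^bsub>G\<^esub> u) g \<union> defect (g \<otimes>\<^bsub>G\<^esub> inv\<^bsub>G\<^esub> u))
        \<le> card (defect g) + card (defect (g \<otimes>\<^bsub>G\<^esub> inv\<^bsub>G\<^esub> u))"
      using ug U by (intro order_trans[OF card_Un_le] add_mono shifted) auto
    thus "real (card (shifted (inv\<^bsub>G\<^esub> u) g \<union> defect (g \<otimes>\<^bsub>G\<^esub> inv\<^bsub>G\<^esub> u)))
        \<le> 8 * (\<delta> / \<eta>)\<^sup>2 * real (card D)"
      using defect[of g] defect[OF F(2)[OF ug(2,1)]] ug F(1) by (auto simp: subset_iff)
  qed
  finally show ?thesis by (simp add: card_cartesian_product)
qed

end

section \<open>Entropy as the growth rate of labelings\<close>

lemma log_enat_sep_number_le: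
  assumes "0 < c"
    and bound: "\<And>A. \<lbrakk>A \<subseteq> Z; finite A; \<And>a b. \<lbrakk>a \<in> A; b \<in> A; a \<noteq> b\<rbrakk> \<Longrightarrow> \<kappa> \<le> d a b\<rbrakk>
           \<Longrightarrow> real (card A) \<le> c"
  shows "log_enat (sep_number \<kappa> Z d) \<le> ereal (ln c)"
proof -
  have "sep_number \<kappa> Z d \<le> enat (nat \<lfloor>c\<rfloor>)"
    unfolding sep_number_def by (intro SUP_least) (auto simp: le_nat_floor bound)
  then obtain m where m: "sep_number \<kappa> Z d = enat m" "m \<le> nat \<lfloor>c\<rfloor>"
    by (cases "sep_number \<kappa> Z d") auto
  hence "real m \<le> c" using \<open>0 < c\<close> by linarith
  thus ?thesis using m by (simp add: log_enat_def)
qed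

lemma log_enat_mono: "enat m \<le> N \<Longrightarrow> 0 < m \<Longrightarrow> ereal (ln (real m)) \<le> log_enat N"
  by (cases N) (auto simp: log_enat_def)

context metric_algebraic_sft
begin

text \<open>The parameters are found before \<open>D\<close> is known: windows and separating set come from
  compactness, \<open>\<beta>\<close> is the density of bad points at which codes are still negligible, and \<open>\<delta>\<close>
  is small enough to keep the bad points below that density.\<close>

lemma sep_number_upper:
  fixes \<epsilon> \<kappa> :: real
  assumes "0 < \<epsilon>" "0 < \<kappa>"
  obtains \<delta> F where "0 < \<delta>" "finite F" "F \<subseteq> carrier G"
    and "\<And>(D :: 'd set) s. finite_model G K X \<rho> D s \<Longrightarrow>
      log_enat (sep_number \<kappa> (Map T (shift G) \<rho> F \<delta> D s) (rho_inf D \<rho>))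
        \<le> ereal (\<epsilon> * real (card D) + ln (real (card (labelings G K X D s))))"
proof -
  obtain V where V: "finite V" "defining_window V" by (rule finite_defining_window)
  obtain B where B: "finite B" "metric_window \<kappa> B" by (rule finite_metric_window[OF \<open>0 < \<kappa>\<close>])
  obtain E \<eta> where E: "finite E" "0 < \<eta>" "separating \<eta> E" by (rule uniformly_generating)
  define U where "U = V \<union> B"
  have U: "finite U" "U \<subseteq> carrier G" and windows: "defining_window U" "metric_window \<kappa> U"
    using windows_union[OF V(2) B(2)] V B by (auto simp: U_def defining_window_def)
  define Q where "Q = (U \<rightarrow>\<^sub>E carrier K) \<times> (U \<rightarrow>\<^sub>E carrier K)"
  have "finite Q" using U finite_K by (auto simp: Q_def intro!: finite_PiE)
  obtain \<beta> where "0 < \<beta>"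
    and codes: "\<And>(D :: 'd set) (Q' :: (('g \<Rightarrow> 'k) \<times> ('g \<Rightarrow> 'k)) set) C.
      \<lbrakk>finite D; finite Q'; card Q' \<le> card Q; C \<subseteq> D \<rightarrow>\<^sub>E insert None (Some ` Q');
       \<And>c. c \<in> C \<Longrightarrow> real (card {d \<in> D. c d \<noteq> None}) \<le> \<beta> * real (card D)\<rbrakk>
         \<Longrightarrow> real (card C) \<le> exp (\<epsilon> * real (card D))"
    using sparse_codes_subexponential[OF \<open>0 < \<epsilon>\<close>, where m = "card Q"] by blast
  define M where "M = real (card U * card E)"
  \<comment> \<open>Solves \<open>8 (M + 1) (\<delta>/\<eta>)\<^sup>2 = \<beta>\<close>; the summand \<open>1\<close> covers an empty window or separating
    set.\<close>
  define \<delta> where "\<delta> = \<eta> * sqrt (\<beta> / (8 * (M + 1)))"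
  have "0 \<le> M" by (simp add: M_def)
  hence "0 < \<delta>" using \<open>0 < \<beta>\<close> \<open>0 < \<eta>\<close> by (simp add: \<delta>_def)
  have "(\<delta> / \<eta>)\<^sup>2 = \<beta> / (8 * (M + 1))"
    using \<open>0 < \<beta>\<close> \<open>0 < \<eta>\<close> \<open>0 \<le> M\<close> by (simp add: \<delta>_def)
  moreover have "M * (8 * (\<beta> / (8 * (M + 1)))) \<le> \<beta>"
    using \<open>0 < \<beta>\<close> \<open>0 \<le> M\<close> by (simp add: field_simps)
  ultimately have \<delta>: "M * (8 * (\<delta> / \<eta>)\<^sup>2) \<le> \<beta>" by simp
  define F where "F = E \<union> (\<lambda>(g, u). g \<otimes>\<^bsub>G\<^esub> inv\<^bsub>G\<^esub> u) ` (E \<times> U)"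
  show thesis
  proof (rule that[OF \<open>0 < \<delta>\<close>, of F])
    show "finite F" "F \<subseteq> carrier G"
      using E U by (auto simp: F_def separating_def subset_iff)
    fix D :: "'d set" and s assume "finite_model G K X \<rho> D s"
    then interpret finite_model G K X \<rho> D s .
    have "log_enat (sep_number \<kappa> (Map T (shift G) \<rho> F \<delta> D s) (rho_inf D \<rho>))
        \<le> ereal (ln (exp (\<epsilon> * real (card D)) * real (card Y)))"
    proof (rule log_enat_sep_number_le)
      fix A assume A: "A \<subseteq> Map T (shift G) \<rho> F \<delta> D s" "finite A"
        and sep: "\<And>\<phi> \<psi>. \<phi> \<in> A \<Longrightarrow> \<psi> \<in> A \<Longrightarrow> \<phi> \<noteq> \<psi> \<Longrightarrow> \<kappa> \<le> rho_inf D \<rho> \<phi> \<psi>"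
      have AX: "A \<subseteq> D \<rightarrow>\<^sub>E X" using A(1) by (auto simp: Map_def)
      have sparse: "real (card (bad U \<phi>)) \<le> \<beta> * real (card D)" if "\<phi> \<in> A" for \<phi>
      proof -
        have "real (card (bad U \<phi>)) \<le> M * (8 * (\<delta> / \<eta>)\<^sup>2 * real (card D))"
          unfolding M_def using E U that A
          by (intro card_bad_le[where F = F]) (auto simp: F_def)
        also have "\<dots> \<le> \<beta> * real (card D)"
          using mult_right_mono[OF \<delta>, of "real (card D)"] by (simp add: mult.assoc)
        finally show ?thesis .
      qed
      have "real (card (code U ` A)) \<le> exp (\<epsilon> * real (card D))"
      proof (rule codes[OF finite_D \<open>finite Q\<close> order_refl])
        show "code U ` A \<subseteq> D \<rightarrow>\<^sub>E insert None (Some ` Q)"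
          using code_in_PiE[OF _ U(2)] AX by (auto simp: Q_def simp del: insert_iff)
        fix c assume "c \<in> code U ` A"
        then obtain \<phi> where "\<phi> \<in> A" "c = code U \<phi>" by blast
        thus "real (card {d \<in> D. c d \<noteq> None}) \<le> \<beta> * real (card D)"
          by (simp only: code_support sparse)
      qed
      moreover have "card A \<le> card (code U ` A) * card Y"
        by (rule card_separated_le[OF windows A(2) AX sep])
      hence "real (card A) \<le> real (card (code U ` A)) * real (card Y)"
        by (simp flip: of_nat_mult)
      ultimately show "real (card A) \<le> exp (\<epsilon> * real (card D)) * real (card Y)"
        by (meson mult_right_mono of_nat_0_le_iff order_trans)
    qed (use card_Y_pos in auto)
    also have "ln (exp (\<epsilon> * real (card D)) * real (card Y)) = \<epsilon> * real (card D) + ln (real (card Y))"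
      using card_Y_pos by (simp add: ln_mult)
    finally show "log_enat (sep_number \<kappa> (Map T (shift G) \<rho> F \<delta> D s) (rho_inf D \<rho>))
        \<le> ereal (\<epsilon> * real (card D) + ln (real (card Y)))" .
  qed
qed

text \<open>The upper bound holds at every scale \<open>\<kappa>\<close>, up to an arbitrarily small \<open>\<epsilon>\<close>; the lower
  bound is already attained at the scale \<open>\<kappa> = \<eta>\<close> of uniform generation.\<close>

theorem sofic_entropy_eq_labelings:
  fixes D :: "nat \<Rightarrow> 'd set"
  assumes model: "\<And>n. finite_model G K X \<rho> (D n) (s n)"
  shows "sofic_entropy G T (shift G) \<rho> D s
    = limsup (\<lambda>n. ereal (1 / real (card (D n)) * ln (real (card (labelings G K X (D n) (s n))))))"
    (is "_ = limsup ?L")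
proof (rule antisym)
  let ?N = "\<lambda>\<kappa> \<delta> F n. ereal (1 / real (card (D n))) *
    log_enat (sep_number \<kappa> (Map T (shift G) \<rho> F \<delta> (D n) (s n)) (rho_inf (D n) \<rho>))"
  have scale: "ereal (1 / real (card (D n))) * x \<le> ereal (1 / real (card (D n))) * y" if "x \<le> y" for n x y
    using that by (intro ereal_mult_left_mono) auto
  have "(INF \<delta>\<in>{0<..}. INF F\<in>{F. finite F \<and> F \<subseteq> carrier G}. limsup (?N \<kappa> \<delta> F)) \<le> limsup ?L"
    if \<kappa>: "0 < \<kappa>" for \<kappa> :: real
  proof (rule ereal_le_epsilon2)
    fix \<epsilon> :: real assume "0 < \<epsilon>"
    then obtain \<delta> F where F: "0 < \<delta>" "finite F" "F \<subseteq> carrier G"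
      and bound: "\<And>(D :: 'd set) s. finite_model G K X \<rho> D s \<Longrightarrow>
        log_enat (sep_number \<kappa> (Map T (shift G) \<rho> F \<delta> D s) (rho_inf D \<rho>))
          \<le> ereal (\<epsilon> * real (card D) + ln (real (card (labelings G K X D s))))"
      using sep_number_upper[OF _ \<kappa>] by blast
    have "?N \<kappa> \<delta> F n \<le> ?L n + ereal \<epsilon>" for n
    proof -
      have "0 < card (D n)" by (rule finite_model.card_D_pos[OF model])
      hence "ereal (1 / real (card (D n)))
          * ereal (\<epsilon> * real (card (D n)) + ln (real (card (labelings G K X (D n) (s n))))) = ?L n + ereal \<epsilon>"
        by (simp add: field_simps)
      thus ?thesis using scale[OF bound[OF model]] by metis
    qed
    hence "limsup (?N \<kappa> \<delta> F) \<le> limsup (\<lambda>n. ?L n + ereal \<epsilon>)"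
      by (intro Limsup_mono always_eventually allI)
    also have "\<dots> = limsup ?L + ereal \<epsilon>"
      by (rule Limsup_add_ereal_right) auto
    finally show "(INF \<delta>\<in>{0<..}. INF F\<in>{F. finite F \<and> F \<subseteq> carrier G}. limsup (?N \<kappa> \<delta> F))
        \<le> limsup ?L + ereal \<epsilon>"
      using F by (intro INF_lower2[of \<delta>] INF_lower2[of F]) auto
  qed
  thus "sofic_entropy G T (shift G) \<rho> D s \<le> limsup ?L"
    unfolding sofic_entropy_def by (intro SUP_least) auto
next
  obtain E \<eta> where E: "finite E" "0 < \<eta>" "separating \<eta> E" by (rule uniformly_generating)
  have "?L n \<le> ereal (1 / real (card (D n))) *
      log_enat (sep_number \<eta> (Map T (shift G) \<rho> F \<delta> (D n) (s n)) (rho_inf (D n) \<rho>))"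
    if "0 < \<delta>" "F \<subseteq> carrier G" for n \<delta> F
  proof -
    interpret finite_model G K X \<rho> "D n" "s n" by (rule model)
    have "ereal (ln (real (card Y)))
        \<le> log_enat (sep_number \<eta> (Map T (shift G) \<rho> F \<delta> (D n) (s n)) (rho_inf (D n) \<rho>))"
      using card_Y_le_sep_number[OF that E(3)] card_Y_pos by (intro log_enat_mono)
    from ereal_mult_left_mono[OF this, of "ereal (1 / real (card (D n)))"] show ?thesis by simp
  qed
  thus "limsup ?L \<le> sofic_entropy G T (shift G) \<rho> D s"
    unfolding sofic_entropy_def using \<open>0 < \<eta>\<close>
    by (intro SUP_upper2[of \<eta>] INF_greatest Limsup_mono always_eventually allI) auto
qed

end

section \<open>Coset spaces and periodic points\<close>

lemma (in group) coset_translate_subgroup: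
  assumes "subgroup H G" "h \<in> H" "u \<in> carrier G"
  shows "H #> (h \<otimes> u) = H #> u"
  using assms coset_mult_assoc[of H h u] coset_join2[of h H] subgroup.subset[OF assms(1)]
  by (auto simp: subset_iff)

lemma (in metric_algebraic_sft) coset_model:
  assumes H: "subgroup H G" and fin: "finite (rcosets\<^bsub>G\<^esub> H)"
  shows "finite_model G K X \<rho> (rcosets\<^bsub>G\<^esub> H) (coset_perm G)"
proof unfold_locales
  have rep: "\<exists>u\<in>carrier G. C = H #>\<^bsub>G\<^esub> u" if "C \<in> rcosets\<^bsub>G\<^esub> H" for C
    using that by (auto simp: RCOSETS_def)
  note perm = coset_perm_rcoset[OF G.group_axioms H]
  show "rcosets\<^bsub>G\<^esub> H \<noteq> {}" by (auto simp: RCOSETS_def)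
  fix C assume "C \<in> rcosets\<^bsub>G\<^esub> H"
  then obtain u where u: "u \<in> carrier G" "C = H #>\<^bsub>G\<^esub> u" using rep by blast
  show "coset_perm G \<one>\<^bsub>G\<^esub> C = C" using u by (simp add: perm)
  fix g assume g: "g \<in> carrier G"
  show "coset_perm G g C \<in> rcosets\<^bsub>G\<^esub> H" using u g by (auto simp: perm RCOSETS_def)
  fix h assume h: "h \<in> carrier G"
  show "coset_perm G (g \<otimes>\<^bsub>G\<^esub> h) C = coset_perm G g (coset_perm G h C)"
    using u g h by (simp add: perm G.inv_mult_group G.m_assoc)
qed (rule fin)

text \<open>A point fixed by \<open>H\<close> is a configuration constant on the cosets \<open>Hu\<close>, thus a labeling
  of \<open>H\G\<close>, which is recovered as the configuration seen from the base point \<open>H\<close>. From \<open>Hu\<close>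
  one sees the translate of that configuration by \<open>u\<inverse>\<close>, so testing membership in \<open>X\<close> at the
  base point is enough.\<close>

lemma (in metric_algebraic_sft) card_coset_labelings:
  assumes H: "subgroup H G"
  shows "card (labelings G K X (rcosets\<^bsub>G\<^esub> H) (coset_perm G)) = card (Fix_points G H X)"
proof (rule bij_betw_same_card[of "\<lambda>a. orbit_config G (coset_perm G) a H"], rule bij_betw_imageI)
  let ?Y = "labelings G K X (rcosets\<^bsub>G\<^esub> H) (coset_perm G)"
  let ?c = "orbit_config G (coset_perm G)"
  have c_H: "?c a H u = a (H #>\<^bsub>G\<^esub> u)" if "u \<in> carrier G" for a u
    using that by (simp add: orbit_config_def coset_perm_def)
  have c: "?c a (H #>\<^bsub>G\<^esub> u) = shift G (inv\<^bsub>G\<^esub> u) (?c a H)" if u: "u \<in> carrier G" for a u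
  proof -
    have "coset_perm G (inv\<^bsub>G\<^esub> h) (H #>\<^bsub>G\<^esub> u) = H #>\<^bsub>G\<^esub> (u \<otimes>\<^bsub>G\<^esub> h)" if "h \<in> carrier G" for h
      using that u by (simp add: coset_perm_rcoset[OF G.group_axioms H])
    thus ?thesis using u by (auto simp: orbit_config_def[of _ _ _ "H #>\<^bsub>G\<^esub> u"] shift_def c_H)
  qed
  have H_coset: "H \<in> rcosets\<^bsub>G\<^esub> H"
    using subgroup.subgroup_in_rcosets[OF H G.group_axioms] .
  show "inj_on (\<lambda>a. ?c a H) ?Y"
  proof (rule inj_onI)
    fix a b assume ab: "a \<in> ?Y" "b \<in> ?Y" "?c a H = ?c b H"
    have "a C = b C" if C: "C \<in> rcosets\<^bsub>G\<^esub> H" for C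
    proof -
      obtain u where "u \<in> carrier G" "C = H #>\<^bsub>G\<^esub> u" using C by (auto simp: RCOSETS_def)
      thus ?thesis using c_H[of u a] c_H[of u b] ab(3) by simp
    qed
    thus "a = b" using ab by (auto simp: labelings_def intro: PiE_ext)
  qed
  show "(\<lambda>a. ?c a H) ` ?Y = Fix_points G H X"
  proof (intro equalityI subsetI)
    fix x assume "x \<in> (\<lambda>a. ?c a H) ` ?Y"
    then obtain a where a: "a \<in> ?Y" "x = ?c a H" by blast
    have x: "x \<in> X" using a H_coset by (auto simp: labelings_def)
    have "shift G g x = x" if "g \<in> H" for g
    proof (rule X_ext)
      have g: "g \<in> carrier G" "inv\<^bsub>G\<^esub> g \<in> H"
        using that H by (auto simp: subgroup.mem_carrier subgroup.m_inv_closed)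
      show "shift G g x \<in> X" "x \<in> X" using x g by auto
      fix h assume "h \<in> carrier G"
      thus "shift G g x h = x h"
        using g by (simp add: a(2) c_H G.coset_translate_subgroup[OF H])
    qed
    thus "x \<in> Fix_points G H X" using x by (auto simp: Fix_points_def)
  next
    fix x assume "x \<in> Fix_points G H X"
    hence x: "x \<in> X" "\<And>g. g \<in> H \<Longrightarrow> shift G g x = x" by (auto simp: Fix_points_def)
    define a where "a = (\<lambda>C\<in>rcosets\<^bsub>G\<^esub> H. x (SOME u. u \<in> C))"
    have a: "a (H #>\<^bsub>G\<^esub> u) = x u" if u: "u \<in> carrier G" for u
    proof -
      have "(SOME v. v \<in> H #>\<^bsub>G\<^esub> u) \<in> H #>\<^bsub>G\<^esub> u"
        using G.rcos_self[OF u H] by (rule someI)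
      then obtain h where h: "h \<in> H" "(SOME v. v \<in> H #>\<^bsub>G\<^esub> u) = h \<otimes>\<^bsub>G\<^esub> u"
        by (auto simp: r_coset_def)
      have hG: "h \<in> carrier G" using h H by (auto simp: subgroup.mem_carrier)
      have "x (h \<otimes>\<^bsub>G\<^esub> u) = shift G (inv\<^bsub>G\<^esub> h) x u" using u hG by simp
      also have "\<dots> = x u" using x(2)[OF subgroup.m_inv_closed[OF H h(1)]] by simp
      finally show ?thesis using h u by (auto simp: a_def RCOSETS_def)
    qed
    have ax: "?c a H = x"
      using x(1) X_subset by (intro PiE_ext[of _ "carrier G" "\<lambda>_. carrier K"])
        (auto simp: c_H a, auto simp: orbit_config_def coset_perm_def a)
    have "a \<in> ?Y"
      using x(1) by (auto simp: labelings_def RCOSETS_def c ax a) (auto simp: a_def RCOSETS_def)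
    thus "x \<in> (\<lambda>a. ?c a H) ` ?Y" using ax by blast
  qed
qed

theorem theorem4p6:
  fixes G :: "('g, 'b) monoid_scheme" and K :: "('k, 'c) monoid_scheme"
    and H :: "nat \<Rightarrow> 'g set" and X :: "('g \<Rightarrow> 'k) set"
    and \<rho> :: "('g \<Rightarrow> 'k) \<Rightarrow> ('g \<Rightarrow> 'k) \<Rightarrow> real"
  assumes "group G" and "countable (carrier G)" and "residually_finite G"
    and "sofic_chain G H"
    and "group K" and "finite (carrier K)"
    and "algebraic_subshift G K X" and "finite_type G K X"
    and "continuous_pseudometric (subtopology (config_topology G K) X) \<rho>"
    and "generating G (subtopology (config_topology G K) X) (shift G) \<rho>"
  shows "sofic_entropy G (subtopology (config_topology G K) X) (shift G) \<rho>
           (\<lambda>n. rcosets\<^bsub>G\<^esub> (H n)) (\<lambda>n. coset_perm G)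
         = limsup (\<lambda>n. ereal (1 / real (card (rcosets\<^bsub>G\<^esub> (H n))) *
                               ln (real (card (Fix_points G (H n) X)))))"
proof -
  interpret metric_algebraic_sft G K X \<rho>
    using assms by (intro metric_algebraic_sft.intro metric_algebraic_sft_axioms.intro)
  have H: "subgroup (H n) G" "finite (rcosets\<^bsub>G\<^esub> (H n))" for n
    using assms by (auto simp: sofic_chain_def)
  show ?thesis
    using sofic_entropy_eq_labelings[OF coset_model[OF H]]
    by (simp add: T_def card_coset_labelings[OF H(1)])
qed

end
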